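(* Let $G$ be a (not necessarily finite) group generated by two elements $x,y$. Suppose that for every non-trivial word $w$ in the free group $F_2=F(X,Y)$ of rank $2$ with (reduced) length smaller than or equal to $21$ we have $w(x,y)\neq e$ in $G$ (equivalently, the girth of the Cayley graph $\Gamma(G,\{x,y\})$ is greater than $21$). Then $G$ admits a Cayley representation.
   Context: For a group $G$ and a non-empty subset $S\subseteq G$, the Cayley poset $P(G,S)$ has as underlying set the disjoint union of two copies $G$ and $G'=\{g' : g\in G\}$ of $G$; for $g,h\in G$ one sets $g<h'$ if and only if $h\in gS$, and no other pair of different points is comparable. Left multiplication on each copy of $G$ gives an action $L:G\to \mathrm{Aut}(P(G,S))$, where $\mathrm{Aut}$ denotes the group of poset automorphisms. If every automorphism of $P(G,S)$ is in the image of $L$, then $P(G,S)$ is called a Cayley representation of $G$. The group $G$ admits a Cayley representation if there is a non-empty $S\subseteq G$ such that $P(G,S)$ is a Cayley representation of $G$. The Cayley graph $\Gamma(G,\{x,y\})$ is the undirected (multi)graph with vertex set $G$ and, for each $g\in G$, one edge with vertices $g,gx$ and another with vertices $g,gy$; loops and multiple edges are allowed. Its girth is the smallest length of a cycle (infinite if the graph is a forest). *)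

theory Defs
  imports
    "HOL-Algebra.Coset"
    "HOL-Algebra.Generated_Groups"
    "HOL-Algebra.Order"
    "HOL-Algebra.Bij"
    "HOL-Library.Extended_Nat"
begin

subsection \<open>Cayley posets\<close>

text \<open>\<^term>\<open>Inl g\<close> is the element \<open>g\<close> of the first copy of the group and
  \<^term>\<open>Inr g\<close> is the element \<open>g'\<close> of the second copy.\<close>

definition cayley_poset :: "('a, 'b) monoid_scheme \<Rightarrow> 'a set \<Rightarrow> ('a + 'a) gorder" where
  "cayley_poset G S =
    \<lparr>carrier = carrier G <+> carrier G,
     eq = (=),
     le = (\<lambda>p q. p = q \<or>
            (\<exists>g\<in>carrier G. \<exists>h\<in>carrier G. p = Inl g \<and> q = Inr h \<and> h \<in> g <#\<^bsub>G\<^esub> S))\<rparr>"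

definition poset_auto :: "('p, 'c) gorder_scheme \<Rightarrow> ('p \<Rightarrow> 'p) set" where
  "poset_auto P =
    {f \<in> Bij (carrier P).
      \<forall>p\<in>carrier P. \<forall>q\<in>carrier P. p \<sqsubseteq>\<^bsub>P\<^esub> q \<longleftrightarrow> f p \<sqsubseteq>\<^bsub>P\<^esub> f q}"

text \<open>The restriction makes the map extensional, as required of members of \<^const>\<open>Bij\<close>.\<close>

definition left_mult :: "('a, 'b) monoid_scheme \<Rightarrow> 'a \<Rightarrow> ('a + 'a \<Rightarrow> 'a + 'a)" where
  "left_mult G g =
    restrict (map_sum (\<lambda>a. g \<otimes>\<^bsub>G\<^esub> a) (\<lambda>a. g \<otimes>\<^bsub>G\<^esub> a)) (carrier G <+> carrier G)"

definition cayley_representation :: "('a, 'b) monoid_scheme \<Rightarrow> 'a set \<Rightarrow> bool" where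
  "cayley_representation G S \<longleftrightarrow>
    poset_auto (cayley_poset G S) \<subseteq> left_mult G ` carrier G"

definition admits_cayley_representation :: "('a, 'b) monoid_scheme \<Rightarrow> bool" where
  "admits_cayley_representation G \<longleftrightarrow>
    (\<exists>S. S \<noteq> {} \<and> S \<subseteq> carrier G \<and> cayley_representation G S)"

lemma partial_order_cayley_poset: "partial_order (cayley_poset G S)"
  by unfold_locales (auto simp: cayley_poset_def)

lemma (in group) left_mult_auto:
  assumes g: "g \<in> carrier G" and S: "S \<subseteq> carrier G"
  shows "left_mult G g \<in> poset_auto (cayley_poset G S)"
proof -
  have bij: "bij_betw (left_mult G g) (carrier G <+> carrier G) (carrier G <+> carrier G)"
    by (rule bij_betw_byWitness[where f' = "left_mult G (inv g)"])
       (use g in \<open>auto simp: left_mult_def m_assoc[symmetric]\<close>)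
  have coset: "g \<otimes> b \<in> (g \<otimes> a) <# S \<longleftrightarrow> b \<in> a <# S"
    if "a \<in> carrier G" "b \<in> carrier G" for a b
    using that g S by (auto simp: l_coset_def m_assoc subset_iff)
  have val: "left_mult G g (Inl a) = Inl (g \<otimes> a)" "left_mult G g (Inr a) = Inr (g \<otimes> a)"
    if "a \<in> carrier G" for a
    using that by (simp_all add: left_mult_def InlI InrI)
  have ext: "left_mult G g \<in> extensional (carrier G <+> carrier G)"
    by (simp add: left_mult_def)
  show ?thesis
    using bij ext g by (auto simp: poset_auto_def Bij_def cayley_poset_def val coset)
qed


subsection \<open>Words in two generators\<close>

datatype generator = Gen_X | Gen_Y

text \<open>\<^term>\<open>(a, False)\<close> is the letter \<open>a\<close> and \<^term>\<open>(a, True)\<close> is its formal inverse.\<close>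

type_synonym letter = "generator \<times> bool"

text \<open>The elements of the free group of rank two, as reduced words; the empty list is
  the trivial element, and the reduced length is the length of the list.\<close>

definition free_words :: "letter list set" where
  "free_words = {w. successively (\<lambda>a b. \<not> (fst a = fst b \<and> snd a \<noteq> snd b)) w}"

fun generator_val :: "'a \<Rightarrow> 'a \<Rightarrow> generator \<Rightarrow> 'a" where
  "generator_val x y Gen_X = x"
| "generator_val x y Gen_Y = y"

fun letter_val :: "('a, 'b) monoid_scheme \<Rightarrow> 'a \<Rightarrow> 'a \<Rightarrow> letter \<Rightarrow> 'a" where
  "letter_val G x y (a, False) = generator_val x y a"
| "letter_val G x y (a, True) = inv\<^bsub>G\<^esub> (generator_val x y a)"

definition word_val :: "('a, 'b) monoid_scheme \<Rightarrow> 'a \<Rightarrow> 'a \<Rightarrow> letter list \<Rightarrow> 'a" where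
  "word_val G x y w = foldr (\<lambda>a u. letter_val G x y a \<otimes>\<^bsub>G\<^esub> u) w \<one>\<^bsub>G\<^esub>"


subsection \<open>Multigraphs and girth\<close>

text \<open>The set of ends of an edge is a two-element set, or a singleton if the edge is a loop.\<close>

record ('v, 'e) multigraph =
  vertices :: "'v set"
  edges :: "'e set"
  ends :: "'e \<Rightarrow> 'v set"

text \<open>The vertices and edges of a cycle are listed in cyclic order. Distinctness of the edges
  matters for length two, where it forces two parallel edges; a cycle of length one is a
  loop.\<close>

definition multigraph_cycle :: "('v, 'e) multigraph \<Rightarrow> 'v list \<Rightarrow> 'e list \<Rightarrow> bool" where
  "multigraph_cycle \<Gamma> vs es \<longleftrightarrow>
    vs \<noteq> [] \<and> length es = length vs \<and> distinct vs \<and> distinct es \<and>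
    set vs \<subseteq> vertices \<Gamma> \<and> set es \<subseteq> edges \<Gamma> \<and>
    (\<forall>i<length vs. ends \<Gamma> (es ! i) = {vs ! i, vs ! (Suc i mod length vs)})"

text \<open>The infimum of the empty set is \<^term>\<open>\<infinity> :: enat\<close>.\<close>

definition girth :: "('v, 'e) multigraph \<Rightarrow> enat" where
  "girth \<Gamma> = Inf {enat (length vs) | vs es. multigraph_cycle \<Gamma> vs es}"

text \<open>Edges are indexed by a group element and a generator, so \<open>x\<close> and \<open>y\<close> give different
  edges even if they are equal or mutually inverse.\<close>

definition cayley_graph ::
  "('a, 'b) monoid_scheme \<Rightarrow> 'a \<Rightarrow> 'a \<Rightarrow> ('a, 'a \<times> generator) multigraph" where
  "cayley_graph G x y =
    \<lparr>vertices = carrier G,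
     edges = carrier G \<times> UNIV,
     ends = (\<lambda>(g, a). {g, g \<otimes>\<^bsub>G\<^esub> generator_val x y a})\<rparr>"

end

theory Submission
  imports Defs
begin

text \<open>Every edge \<open>g < (gs)'\<close> of the Cayley poset carries the label \<open>s\<close>. The number of paths
  \<open>g < b' > a < (gs)'\<close> is invariant under automorphisms and depends on \<open>s\<close> only: it is the number
  of ways to write \<open>s = u v\<inverse> t\<close> with \<open>u, v, t \<in> S\<close>. For
  \<open>S = {1, x, y, x\<inverse>, x\<^sup>2, y\<^sup>2}\<close> in a group without short relations this number
  is 17, 16, 13, 14, 14, 12, respectively, so that an automorphism preserves the edges labelled by
  \<open>1\<close>, \<open>x\<close> and \<open>y\<close>; as \<open>x\<close> and \<open>y\<close> generate the group, it is a left multiplication.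
  Relations of length at most 8 are the only ones that could disturb the count.\<close>

subsection \<open>Automorphisms and edge labels\<close>

definition factorizations :: "('a, 'b) monoid_scheme \<Rightarrow> 'a set \<Rightarrow> 'a \<Rightarrow> ('a \<times> 'a \<times> 'a) set" where
  "factorizations G S s =
    {(u, v, t) \<in> S \<times> S \<times> S. u \<otimes>\<^bsub>G\<^esub> inv\<^bsub>G\<^esub> v \<otimes>\<^bsub>G\<^esub> t = s}"

text \<open>The pair \<open>(b, a)\<close> stands for the path \<open>g < b' > a < h'\<close>.
  Degenerate paths with \<open>a = g\<close> or \<open>b = h\<close> are included; for
  \<open>h = g s\<close> they match the factorizations with \<open>u = v\<close> or
  \<open>v = t\<close>.\<close>

definition zigzags :: "('a, 'b) monoid_scheme \<Rightarrow> 'a set \<Rightarrow> 'a \<Rightarrow> 'a \<Rightarrow> ('a \<times> 'a) set" where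
  "zigzags G S g h =
    {(b, a) \<in> carrier G \<times> carrier G.
      b \<in> g <#\<^bsub>G\<^esub> S \<and> b \<in> a <#\<^bsub>G\<^esub> S \<and> h \<in> a <#\<^bsub>G\<^esub> S}"

context group
begin

text \<open>A zigzag is determined by the labels \<open>u\<close>, \<open>v\<close>,
  \<open>t\<close> of its three edges: its inner points are \<open>b = g u\<close> and
  \<open>a = g u v^-1\<close>, and it ends at \<open>g s\<close> exactly when
  \<open>u v^-1 t = s\<close>. Hence the count does not depend on \<open>g\<close>.\<close>

lemma card_zigzags:
  assumes S: "S \<subseteq> carrier G" and g: "g \<in> carrier G" and s: "s \<in> S"
  shows "card (zigzags G S g (g \<otimes> s)) = card (factorizations G S s)"
proof -
  have "bij_betw (\<lambda>(u, v, t). (g \<otimes> u, g \<otimes> u \<otimes> inv v))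
      (factorizations G S s) (zigzags G S g (g \<otimes> s))"
    unfolding bij_betw_def
  proof
    show "inj_on (\<lambda>(u, v, t). (g \<otimes> u, g \<otimes> u \<otimes> inv v)) (factorizations G S s)"
    proof (rule inj_onI)
      fix p q
      assume pq: "p \<in> factorizations G S s" "q \<in> factorizations G S s"
        and eq: "(\<lambda>(u, v, t). (g \<otimes> u, g \<otimes> u \<otimes> inv v)) p = (\<lambda>(u, v, t). (g \<otimes> u, g \<otimes> u \<otimes> inv v)) q"
      obtain u v t u' v' t' where uvt: "p = (u, v, t)" "q = (u', v', t')"
        by (metis prod_cases3)
      with pq have 1: "(u, v, t) \<in> factorizations G S s" "(u', v', t') \<in> factorizations G S s"
        by auto
      from eq uvt have 2: "g \<otimes> u = g \<otimes> u'" "g \<otimes> u \<otimes> inv v = g \<otimes> u' \<otimes> inv v'"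
        by auto
      have c: "u \<in> carrier G" "v \<in> carrier G" "t \<in> carrier G"
        "u' \<in> carrier G" "v' \<in> carrier G" "t' \<in> carrier G"
        using 1 S by (auto simp: factorizations_def)
      have "u = u'" using 2 c g by simp
      moreover have "inv v = inv v'" using 2 c g \<open>u = u'\<close> by simp
      then have "v = v'" using c by (metis inv_inv)
      moreover have "u \<otimes> inv v \<otimes> t = u' \<otimes> inv v' \<otimes> t'"
        using 1 by (auto simp: factorizations_def)
      ultimately show "p = q" using c uvt by simp
    qed
    show "(\<lambda>(u, v, t). (g \<otimes> u, g \<otimes> u \<otimes> inv v)) ` factorizations G S s
        = zigzags G S g (g \<otimes> s)"
    proof (intro equalityI subsetI; clarify)
      fix u v t assume 1: "(u, v, t) \<in> factorizations G S s"
      then have S3: "u \<in> S" "v \<in> S" "t \<in> S" and e: "s = u \<otimes> inv v \<otimes> t"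
        by (auto simp: factorizations_def)
      have c: "u \<in> carrier G" "v \<in> carrier G" "t \<in> carrier G" using S3 S by auto
      have "g \<otimes> u = g \<otimes> u \<otimes> inv v \<otimes> v" "g \<otimes> s = g \<otimes> u \<otimes> inv v \<otimes> t"
        using c g by (simp_all add: m_assoc e)
      then show "(g \<otimes> u, g \<otimes> u \<otimes> inv v) \<in> zigzags G S g (g \<otimes> s)"
        using S3 c g by (auto simp: zigzags_def l_coset_def)
    next
      fix b a assume "(b, a) \<in> zigzags G S g (g \<otimes> s)"
      then obtain u v t where S3: "u \<in> S" "v \<in> S" "t \<in> S" and a: "a \<in> carrier G"
        and e: "b = g \<otimes> u" "b = a \<otimes> v" "g \<otimes> s = a \<otimes> t"
        by (auto simp: zigzags_def l_coset_def)
      have c: "u \<in> carrier G" "v \<in> carrier G" "t \<in> carrier G" "s \<in> carrier G"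
        using S3 S s by auto
      have a': "a = g \<otimes> u \<otimes> inv v"
        using e a c g by (metis inv_solve_right m_closed)
      then have "g \<otimes> s = g \<otimes> (u \<otimes> inv v \<otimes> t)"
        using e c g by (simp add: m_assoc)
      then have "u \<otimes> inv v \<otimes> t = s" using c g by simp
      then have "(u, v, t) \<in> factorizations G S s"
        using S3 by (simp add: factorizations_def)
      then show "(b, a) \<in> (\<lambda>(u, v, t). (g \<otimes> u, g \<otimes> u \<otimes> inv v)) ` factorizations G S s"
        using e a' by (auto intro: rev_image_eqI)
    qed
  qed
  from bij_betw_same_card[OF this] show ?thesis by simp
qed

text \<open>Since \<open>\<one> \<in> S\<close>, every \<open>g\<close> lies strictly below
  \<open>g'\<close>: points of the first copy are never maximal and points of the second never
  minimal, so an automorphism cannot mix the copies.\<close>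

lemma poset_auto_levels:
  assumes S: "S \<subseteq> carrier G" "\<one> \<in> S" and f: "f \<in> poset_auto (cayley_poset G S)"
  obtains \<phi> \<psi> where "bij_betw \<phi> (carrier G) (carrier G)" "bij_betw \<psi> (carrier G) (carrier G)"
    and "\<And>g. g \<in> carrier G \<Longrightarrow> f (Inl g) = Inl (\<phi> g)"
    and "\<And>g. g \<in> carrier G \<Longrightarrow> f (Inr g) = Inr (\<psi> g)"
    and "\<And>g h. g \<in> carrier G \<Longrightarrow> h \<in> carrier G \<Longrightarrow>
      h \<in> g <# S \<longleftrightarrow> \<psi> h \<in> \<phi> g <# S"
proof -
  let ?P = "cayley_poset G S" and ?C = "carrier G <+> carrier G"
  define \<phi> where "\<phi> = (\<lambda>g. projl (f (Inl g)))"
  define \<psi> where "\<psi> = (\<lambda>g. projr (f (Inr g)))"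
  have bij: "bij_betw f ?C ?C"
    using f by (simp add: poset_auto_def Bij_def cayley_poset_def)
  have ord: "p \<sqsubseteq>\<^bsub>?P\<^esub> q \<longleftrightarrow> f p \<sqsubseteq>\<^bsub>?P\<^esub> f q" if "p \<in> ?C" "q \<in> ?C" for p q
    using f that by (simp add: poset_auto_def cayley_poset_def)
  have inj: "f p = f q \<longleftrightarrow> p = q" if "p \<in> ?C" "q \<in> ?C" for p q
    using bij_betw_imp_inj_on[OF bij] that by (rule inj_on_eq_iff)
  have both: "f (Inl g) = Inl (\<phi> g) \<and> f (Inr g) = Inr (\<psi> g) \<and> \<phi> g \<in> carrier G \<and> \<psi> g \<in> carrier G"
    if g: "g \<in> carrier G" for g
  proof -
    have "g \<in> g <# S" using g S by (force simp: l_coset_def)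
    then have "Inl g \<sqsubseteq>\<^bsub>?P\<^esub> Inr g" using g by (simp add: cayley_poset_def)
    \<comment> \<open>A strict comparability has its lower point in the first copy and its upper
      point in the second, which settles the side of both images.\<close>
    then have "f (Inl g) \<sqsubseteq>\<^bsub>?P\<^esub> f (Inr g)" using ord g by blast
    moreover have "f (Inl g) \<noteq> f (Inr g)" using inj[of "Inl g" "Inr g"] g by auto
    ultimately show ?thesis by (auto simp: cayley_poset_def \<phi>_def \<psi>_def)
  qed
  have im: "\<exists>p\<in>?C. f p = q" if "q \<in> ?C" for q
    using bij_betw_imp_surj_on[OF bij] that by (metis imageE)
  have "bij_betw \<phi> (carrier G) (carrier G)"
    unfolding bij_betw_def
  proof (intro conjI inj_onI equalityI subsetI)
    show "g = h" if "g \<in> carrier G" "h \<in> carrier G" "\<phi> g = \<phi> h" for g h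
      using inj[of "Inl g" "Inl h"] both that by auto
    show "k \<in> carrier G" if "k \<in> \<phi> ` carrier G" for k using that both by auto
    show "k \<in> \<phi> ` carrier G" if k: "k \<in> carrier G" for k
    proof -
      obtain p where p: "p \<in> ?C" "f p = Inl k" using im k by blast
      then obtain g where "g \<in> carrier G" "p = Inl g" using both by (metis PlusE sum.distinct(1))
      then show ?thesis using p both by (metis imageI sum.inject)
    qed
  qed
  moreover have "bij_betw \<psi> (carrier G) (carrier G)"
    unfolding bij_betw_def
  proof (intro conjI inj_onI equalityI subsetI)
    show "g = h" if "g \<in> carrier G" "h \<in> carrier G" "\<psi> g = \<psi> h" for g h
      using inj[of "Inr g" "Inr h"] both that by auto
    show "k \<in> carrier G" if "k \<in> \<psi> ` carrier G" for k using that both by auto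
    show "k \<in> \<psi> ` carrier G" if k: "k \<in> carrier G" for k
    proof -
      obtain p where p: "p \<in> ?C" "f p = Inr k" using im k by blast
      then obtain g where "g \<in> carrier G" "p = Inr g" using both by (metis PlusE sum.distinct(1))
      then show ?thesis using p both by (metis imageI sum.inject)
    qed
  qed
  moreover have "h \<in> g <# S \<longleftrightarrow> \<psi> h \<in> \<phi> g <# S" if "g \<in> carrier G" "h \<in> carrier G" for g h
    using ord[of "Inl g" "Inr h"] both that by (auto simp: cayley_poset_def)
  ultimately show thesis using that both by blast
qed

text \<open>Zigzags are described by the edge relation alone, and \<open>edge\<close> is an
  equivalence, so the two level maps carry zigzags onto zigzags.\<close>

lemma card_zigzags_transport:
  assumes \<phi>: "bij_betw \<phi> (carrier G) (carrier G)" and \<psi>: "bij_betw \<psi> (carrier G) (carrier G)"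
    and edge: "\<And>g h. g \<in> carrier G \<Longrightarrow> h \<in> carrier G \<Longrightarrow>
      h \<in> g <# S \<longleftrightarrow> \<psi> h \<in> \<phi> g <# S"
    and "g \<in> carrier G" "h \<in> carrier G"
  shows "card (zigzags G S (\<phi> g) (\<psi> h)) = card (zigzags G S g h)"
proof -
  \<comment> \<open>In a zigzag \<open>(b, a)\<close> the point \<open>b\<close> is in the upper
    copy and \<open>a\<close> in the lower one, hence \<open>\<psi>\<close> comes first.\<close>
  have bij: "bij_betw (map_prod \<psi> \<phi>) (carrier G \<times> carrier G) (carrier G \<times> carrier G)"
    using \<phi> \<psi> by (rule bij_betw_map_prod[rotated])
  have sub: "zigzags G S k l \<subseteq> carrier G \<times> carrier G" for k l
    by (auto simp: zigzags_def)
  have "bij_betw (map_prod \<psi> \<phi>) (zigzags G S g h) (zigzags G S (\<phi> g) (\<psi> h))"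
  proof (rule bij_betw_subset[OF bij])
    show "zigzags G S g h \<subseteq> carrier G \<times> carrier G" by (rule sub)
    have *: "map_prod \<psi> \<phi> p \<in> zigzags G S (\<phi> g) (\<psi> h) \<longleftrightarrow> p \<in> zigzags G S g h"
      if "p \<in> carrier G \<times> carrier G" for p
    proof (cases p)
      case (Pair b a)
      with that have ba: "b \<in> carrier G" "a \<in> carrier G" by auto
      have "\<psi> b \<in> carrier G" "\<phi> a \<in> carrier G" using ba \<phi> \<psi> bij_betwE by blast+
      then show ?thesis
        using ba Pair edge[OF assms(4) ba(1)] edge[OF ba(2,1)] edge[OF ba(2) assms(5)]
        by (simp add: zigzags_def)
    qed
    show "map_prod \<psi> \<phi> ` zigzags G S g h = zigzags G S (\<phi> g) (\<psi> h)"
    proof (rule equalityI; rule subsetI)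
      fix q assume "q \<in> map_prod \<psi> \<phi> ` zigzags G S g h"
      then obtain p where p: "p \<in> zigzags G S g h" "q = map_prod \<psi> \<phi> p" by (rule imageE)
      from sub p(1) have "p \<in> carrier G \<times> carrier G" by (rule subsetD)
      from *[OF this] p show "q \<in> zigzags G S (\<phi> g) (\<psi> h)" by simp
    next
      fix q assume q: "q \<in> zigzags G S (\<phi> g) (\<psi> h)"
      with sub have "q \<in> carrier G \<times> carrier G" by (rule subsetD)
      then have "q \<in> map_prod \<psi> \<phi> ` (carrier G \<times> carrier G)"
        using bij_betw_imp_surj_on[OF bij] by simp
      then obtain p where p: "q = map_prod \<psi> \<phi> p" "p \<in> carrier G \<times> carrier G" by (rule imageE)
      with *[OF p(2)] q have "p \<in> zigzags G S g h" by simp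
      with p(1) show "q \<in> map_prod \<psi> \<phi> ` zigzags G S g h" by (rule image_eqI)
    qed
  qed
  from bij_betw_same_card[OF this] show ?thesis by simp
qed

text \<open>An edge labelled \<open>t \<in> T\<close> goes to an edge whose label has the same
  number of factorizations, and \<open>sep\<close> leaves only \<open>t\<close>. Labels outside
  \<open>T\<close> may share their counts with each other; controlling \<open>T\<close> suffices
  because it generates the group.\<close>

lemma cayley_representationI:
  assumes S: "S \<subseteq> carrier G" and T: "T \<subseteq> S" "\<one> \<in> T" and gen: "generate G T = carrier G"
    and sep: "\<And>s t. s \<in> S \<Longrightarrow> t \<in> T \<Longrightarrow>
      card (factorizations G S s) = card (factorizations G S t) \<Longrightarrow> s = t"
  shows "cayley_representation G S"
  unfolding cayley_representation_def
proof
  fix f assume f: "f \<in> poset_auto (cayley_poset G S)"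
  have "\<one> \<in> S" using T by auto
  obtain \<phi> \<psi> where \<phi>: "bij_betw \<phi> (carrier G) (carrier G)"
    and \<psi>: "bij_betw \<psi> (carrier G) (carrier G)"
    and fl: "\<And>g. g \<in> carrier G \<Longrightarrow> f (Inl g) = Inl (\<phi> g)"
    and fr: "\<And>g. g \<in> carrier G \<Longrightarrow> f (Inr g) = Inr (\<psi> g)"
    and edge: "\<And>g h. g \<in> carrier G \<Longrightarrow> h \<in> carrier G \<Longrightarrow>
      h \<in> g <# S \<longleftrightarrow> \<psi> h \<in> \<phi> g <# S"
    using poset_auto_levels[OF S \<open>\<one> \<in> S\<close> f] by metis
  have \<phi>c: "\<phi> g \<in> carrier G" if "g \<in> carrier G" for g using \<phi> that bij_betwE by blast
  have label: "\<psi> (g \<otimes> t) = \<phi> g \<otimes> t" if g: "g \<in> carrier G" and t: "t \<in> T" for g t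
  proof -
    have tS: "t \<in> S" and tc: "t \<in> carrier G" using t T S by auto
    have "g \<otimes> t \<in> g <# S" using tS by (auto simp: l_coset_def)
    then obtain s where s: "s \<in> S" "\<psi> (g \<otimes> t) = \<phi> g \<otimes> s"
      using edge[of g "g \<otimes> t"] g tc by (auto simp: l_coset_def)
    have "card (factorizations G S s) = card (zigzags G S (\<phi> g) (\<psi> (g \<otimes> t)))"
      using card_zigzags[OF S \<phi>c[OF g]] s by simp
    also have "\<dots> = card (zigzags G S g (g \<otimes> t))"
      using card_zigzags_transport[OF \<phi> \<psi> edge] g tc by simp
    also have "\<dots> = card (factorizations G S t)"
      using card_zigzags[OF S g tS] .
    finally show ?thesis using sep[OF s(1) t] s(2) by simp
  qed
  \<comment> \<open>The label \<open>\<one>\<close> joins \<open>g\<close> to \<open>g'\<close>. As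
    it is preserved, both copies are moved by the same map.\<close>
  have \<psi>\<phi>: "\<psi> g = \<phi> g" if "g \<in> carrier G" for g
    using label[OF that T(2)] that \<phi>c by simp
  have step: "\<phi> (g \<otimes> t) = \<phi> g \<otimes> t" if "g \<in> carrier G" "t \<in> T" for g t
    using label[OF that] \<psi>\<phi>[of "g \<otimes> t"] that T S by auto
  \<comment> \<open>Commuting with right multiplication by \<open>T\<close> extends to the generated
    subgroup. The quantifier over \<open>g\<close> sits inside the induction because products and
    inverses shift the base point.\<close>
  have "\<forall>g\<in>carrier G. k \<in> carrier G \<and> \<phi> (g \<otimes> k) = \<phi> g \<otimes> k" if "k \<in> generate G T" for k
    using that
  proof (induction rule: generate.induct)
    case one
    then show ?case using \<phi>c by simp
  next
    case (incl t)
    then show ?case using step T S by auto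
  next
    case (inv t)
    then have t: "t \<in> carrier G" using T S by auto
    have "\<phi> (g \<otimes> inv t) = \<phi> g \<otimes> inv t" if g: "g \<in> carrier G" for g
      using step[of "g \<otimes> inv t" t] inv g t \<phi>c by (simp add: m_assoc inv_solve_right)
    then show ?case using t by simp
  next
    case (eng k l)
    then have kl: "k \<in> carrier G" "l \<in> carrier G" using one_closed by blast+
    have "\<phi> (g \<otimes> (k \<otimes> l)) = \<phi> g \<otimes> (k \<otimes> l)" if g: "g \<in> carrier G" for g
      using eng kl g \<phi>c by (simp add: m_assoc[symmetric])
    then show ?case using kl by simp
  qed
  \<comment> \<open>At base point \<open>\<one>\<close> this says that \<open>\<phi>\<close> is left
    multiplication by \<open>\<phi> \<one>\<close>.\<close>
  then have hom: "\<phi> k = \<phi> \<one> \<otimes> k" if "k \<in> carrier G" for k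
    using that gen by (metis l_one one_closed)
  have "f = left_mult G (\<phi> \<one>)"
  proof (rule extensionalityI[where A = "carrier G <+> carrier G"])
    show "f \<in> extensional (carrier G <+> carrier G)"
      using f by (simp add: poset_auto_def Bij_def cayley_poset_def)
    show "left_mult G (\<phi> \<one>) \<in> extensional (carrier G <+> carrier G)"
      by (simp add: left_mult_def)
    show "f p = left_mult G (\<phi> \<one>) p" if "p \<in> carrier G <+> carrier G" for p
    proof (cases p)
      case (Inl g)
      then show ?thesis using that fl[of g] hom[of g] by (auto simp: left_mult_def)
    next
      case (Inr g)
      then show ?thesis using that fr[of g] \<psi>\<phi>[of g] hom[of g] by (auto simp: left_mult_def)
    qed
  qed
  then show "f \<in> left_mult G ` carrier G" using \<phi>c by blast
qed

end


subsection \<open>Free reduction\<close>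

definition inverse_letters :: "letter \<Rightarrow> letter \<Rightarrow> bool" where
  "inverse_letters a b \<longleftrightarrow> fst a = fst b \<and> snd a \<noteq> snd b"

definition reduced :: "letter list \<Rightarrow> bool" where
  "reduced w \<longleftrightarrow> successively (\<lambda>a b. \<not> inverse_letters a b) w"

lemma free_words_reduced: "w \<in> free_words \<longleftrightarrow> reduced w"
  by (simp add: free_words_def reduced_def inverse_letters_def)

text \<open>On reduced words this is left multiplication by one letter in the free group: only the
  first letter can cancel.\<close>

fun cons_reduce :: "letter \<Rightarrow> letter list \<Rightarrow> letter list" where
  "cons_reduce a [] = [a]"
| "cons_reduce a (b # w) = (if inverse_letters a b then w else a # b # w)"

fun reduce :: "letter list \<Rightarrow> letter list" where
  "reduce [] = []"
| "reduce (a # w) = cons_reduce a (reduce w)"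

definition word_inv :: "letter list \<Rightarrow> letter list" where
  "word_inv w = rev (map (\<lambda>(a, b). (a, \<not> b)) w)"

lemma reduced_cons_reduce: "reduced w \<Longrightarrow> reduced (cons_reduce a w)"
  by (cases w) (auto simp: reduced_def successively_Cons)

lemma reduced_reduce: "reduced (reduce w)"
  by (induction w) (auto intro: reduced_cons_reduce simp: reduced_def[of "[]"])

lemma length_reduce_le: "length (reduce w) \<le> length w"
proof (induction w)
  case (Cons a w)
  have "length (cons_reduce a v) \<le> Suc (length v)" for v by (cases v) auto
  then show ?case using Cons by (metis Suc_le_mono le_trans length_Cons reduce.simps(2))
qed simp

lemma reduced_sublist: "reduced (u @ v @ w) \<Longrightarrow> reduced v"
  by (simp add: reduced_def successively_append_iff)

section \<open>Evaluation of words at two group elements\<close>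

locale generator_pair = group G for G (structure) +
  fixes x y :: 'a
  assumes x_closed: "x \<in> carrier G" and y_closed: "y \<in> carrier G"
begin

abbreviation val :: "letter list \<Rightarrow> 'a" where
  "val \<equiv> word_val G x y"

lemma letter_closed: "letter_val G x y a \<in> carrier G"
proof (cases a)
  case (Pair c b)
  then show ?thesis by (cases c; cases b) (simp_all add: x_closed y_closed)
qed

lemma val_Nil: "val [] = \<one>"
  by (simp add: word_val_def)

lemma val_Cons: "val (a # w) = letter_val G x y a \<otimes> val w"
  by (simp add: word_val_def)

lemma val_closed: "val w \<in> carrier G"
  by (induction w) (simp_all add: val_Nil val_Cons letter_closed)

lemma val_append: "val (v @ w) = val v \<otimes> val w"
  by (induction v) (simp_all add: val_Nil val_Cons letter_closed val_closed m_assoc)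

lemma letter_val_inverse:
  assumes "inverse_letters a b"
  shows "letter_val G x y b = inv (letter_val G x y a)"
proof (cases a; cases b)
  fix c d c' d' assume "a = (c, d)" "b = (c', d')"
  then show ?thesis
    using assms by (cases c; cases d; cases d') (auto simp: inverse_letters_def x_closed y_closed)
qed

lemma val_word_inv: "val (word_inv w) = inv (val w)"
proof (induction w)
  case (Cons a w)
  have "inverse_letters a (fst a, \<not> snd a)" by (simp add: inverse_letters_def)
  from letter_val_inverse[OF this] Cons show ?case
    by (simp add: word_inv_def val_append val_Cons val_Nil inv_mult_group letter_closed val_closed
        split_def)
qed (simp add: word_inv_def val_Nil)

lemma val_reduce: "val (reduce w) = val w"
proof (induction w)
  case (Cons a w)
  have "val (cons_reduce a v) = letter_val G x y a \<otimes> val v" for v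
    by (cases v)
       (auto simp: val_Cons val_Nil letter_val_inverse letter_closed val_closed m_assoc[symmetric])
  then show ?case using Cons by (simp add: val_Cons)
qed simp

definition free_up_to :: "nat \<Rightarrow> bool" where
  "free_up_to n \<longleftrightarrow> (\<forall>w\<in>free_words. w \<noteq> [] \<and> length w \<le> n \<longrightarrow> val w \<noteq> \<one>)"

text \<open>Reduction preserves the value and does not lengthen the word, so a non-empty reduction
  would be a forbidden relation of length at most \<open>n\<close>. Equations between short words
  thus become computations in the free group.\<close>

lemma val_eq_one_iff:
  assumes "free_up_to n" "length w \<le> n"
  shows "val w = \<one> \<longleftrightarrow> reduce w = []"
proof
  show "reduce w = []" if "val w = \<one>"
    using assms that val_reduce[of w] reduced_reduce[of w] length_reduce_le[of w]
    by (auto simp: free_up_to_def free_words_reduced)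
  show "val w = \<one>" if "reduce w = []"
    using val_reduce[of w] that by (simp add: val_Nil)
qed

end


subsection \<open>Counting factorizations of words\<close>

text \<open>The free-group counterpart of the number of factorizations: \<open>u v^-1 t = s\<close>
  is tested by reducing \<open>u v^-1 t s^-1\<close>, so the count can be evaluated.\<close>

definition word_factorizations :: "letter list list \<Rightarrow> letter list \<Rightarrow> nat" where
  "word_factorizations L s =
    (\<Sum>u\<leftarrow>L. \<Sum>v\<leftarrow>L. length (filter (\<lambda>t. reduce (u @ word_inv v @ t @ word_inv s) = []) L))"

lemma length_filter_product:
  "length (filter P (List.product xs ys)) = (\<Sum>x\<leftarrow>xs. length (filter (\<lambda>y. P (x, y)) ys))"
  by (induction xs) (simp_all add: filter_map o_def)

context generator_pair
begin

lemma val_quotient_eq_one_iff: "val (v @ word_inv w) = \<one> \<longleftrightarrow> val v = val w"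
  using inv_solve_right'[of \<one> "val v" "val w"]
  by (auto simp: val_append val_word_inv val_closed)

text \<open>The relation \<open>u v^-1 t s^-1\<close> is built from four words of the list, hence
  the factor 4: its length is at most \<open>n\<close>, where it holds in the group only if it holds
  in the free group. Injectivity of \<open>val\<close> matches triples of words with triples of
  elements.\<close>

lemma card_factorizations_val:
  assumes free: "free_up_to n" and short: "\<And>w. w \<in> set L \<Longrightarrow> 4 * length w \<le> n"
    and "distinct L" and inj: "inj_on val (set L)" and s: "s \<in> set L"
  shows "card (factorizations G (val ` set L) (val s)) = word_factorizations L s"
proof -
  let ?R = "\<lambda>(u, v, t). reduce (u @ word_inv v @ t @ word_inv s) = []"
  let ?F = "set (filter ?R (List.product L (List.product L L)))"
  let ?m = "map_prod val (map_prod val val)"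
  have R: "val u \<otimes> inv (val v) \<otimes> val t = val s \<longleftrightarrow> ?R (u, v, t)"
    if "u \<in> set L" "v \<in> set L" "t \<in> set L" for u v t
  proof -
    have "length (u @ word_inv v @ t @ word_inv s) \<le> n"
      using short[OF that(1)] short[OF that(2)] short[OF that(3)] short[OF s]
      by (simp add: word_inv_def)
    from val_eq_one_iff[OF free this] val_quotient_eq_one_iff[of "u @ word_inv v @ t" s]
    show ?thesis by (simp add: val_append val_word_inv val_closed m_assoc)
  qed
  have "factorizations G (val ` set L) (val s) = ?m ` ?F"
  proof (intro equalityI subsetI)
    fix p assume "p \<in> factorizations G (val ` set L) (val s)"
    then obtain u v t where "u \<in> set L" "v \<in> set L" "t \<in> set L" "p = ?m (u, v, t)"
      "val u \<otimes> inv (val v) \<otimes> val t = val s"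
      by (auto simp: factorizations_def)
    then show "p \<in> ?m ` ?F" using R by (intro image_eqI[of _ _ "(u, v, t)"]) auto
  next
    fix p assume "p \<in> ?m ` ?F"
    then show "p \<in> factorizations G (val ` set L) (val s)"
      using R by (auto simp: factorizations_def)
  qed
  moreover have "inj_on ?m ?F"
    by (rule inj_on_subset[OF map_prod_inj_on[OF inj map_prod_inj_on[OF inj inj]]]) auto
  ultimately have "card (factorizations G (val ` set L) (val s)) = card ?F"
    by (simp add: card_image)
  also have "\<dots> = word_factorizations L s"
    by (subst distinct_card)
       (simp_all add: word_factorizations_def length_filter_product distinct_product \<open>distinct L\<close>)
  finally show ?thesis .
qed

end

section \<open>The connection set and its counts\<close>

definition connection_words :: "letter list list" where
  "connection_words =
    [[], [(Gen_X, False)], [(Gen_Y, False)], [(Gen_X, True)],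
     [(Gen_X, False), (Gen_X, False)], [(Gen_Y, False), (Gen_Y, False)]]"

text \<open>The counts 17, 16, 13 of the empty word, \<open>x\<close> and \<open>y\<close> occur
  once each. The tie at 14 is between \<open>x^-1\<close> and \<open>x^2\<close>, which are not
  among the labels to be recognized.\<close>

lemma word_factorizations_connection_words:
  "map (word_factorizations connection_words) connection_words = [17, 16, 13, 14, 14, 12]"
  by code_simp

text \<open>The six words represent different elements of the free group, which makes
  \<open>val\<close> injective on them once short relations are excluded.\<close>

lemma connection_words_separated:
  "\<forall>s\<in>set connection_words. \<forall>t\<in>set connection_words. reduce (s @ word_inv t) = [] \<longrightarrow> s = t"
  by code_simp

text \<open>The bound 8 is four times 2, the greatest length of a connection word.\<close>

lemma (in generator_pair) admits_cayley_representation: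
  assumes gen: "generate G {x, y} = carrier G" and free: "free_up_to 8"
  shows "admits_cayley_representation G"
proof -
  let ?L = connection_words
  let ?S = "val ` set ?L"
  \<comment> \<open>The labels \<open>\<one>\<close>, \<open>x\<close>, \<open>y\<close>, whose
    counts no other label shares.\<close>
  let ?T = "val ` {[], [(Gen_X, False)], [(Gen_Y, False)]}"
  have short: "4 * length w \<le> 8" if "w \<in> set ?L" for w
    using that by (auto simp: connection_words_def)
  have inj: "inj_on val (set ?L)"
  proof (rule inj_onI)
    fix s t assume st: "s \<in> set ?L" "t \<in> set ?L" "val s = val t"
    have "length (s @ word_inv t) \<le> 8"
      using short[OF st(1)] short[OF st(2)] by (simp add: word_inv_def)
    then have "reduce (s @ word_inv t) = []"
      using val_eq_one_iff[OF free] val_quotient_eq_one_iff st(3) by blast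
    then show "s = t" using connection_words_separated st by blast
  qed
  have "distinct ?L" by (simp add: connection_words_def)
  note count = card_factorizations_val[OF free short this inj]
  have sep: "s = t" if "s \<in> set ?L" "t \<in> {[], [(Gen_X, False)], [(Gen_Y, False)]}"
    "word_factorizations ?L s = word_factorizations ?L t" for s t
    using that word_factorizations_connection_words by (auto simp: connection_words_def)
  have "cayley_representation G ?S"
  proof (rule cayley_representationI[where T = ?T])
    show "?S \<subseteq> carrier G" using val_closed by auto
    show "?T \<subseteq> ?S" by (rule image_mono) (simp add: connection_words_def)
    show "\<one> \<in> ?T" by (simp add: val_Nil)
    have "{x, y} \<subseteq> ?T" by (auto simp: val_Nil val_Cons x_closed y_closed)
    moreover have "?T \<subseteq> carrier G" using val_closed by auto
    ultimately show "generate G ?T = carrier G"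
      using mono_generate[of "{x, y}" ?T] generate_incl[of ?T] gen by auto
    show "s = t" if "s \<in> ?S" "t \<in> ?T"
      "card (factorizations G ?S s) = card (factorizations G ?S t)" for s t
    proof -
      note st = that
      obtain v where v: "s = val v" "v \<in> set ?L" using st(1) by (rule imageE)
      obtain w where w: "t = val w" "w \<in> {[], [(Gen_X, False)], [(Gen_Y, False)]}"
        using st(2) by (rule imageE)
      then have "w \<in> set ?L" by (auto simp: connection_words_def)
      with v w st(3) have "word_factorizations ?L v = word_factorizations ?L w"
        using count by simp
      then show "s = t" using sep[OF v(2) w(2)] v(1) w(1) by simp
    qed
  qed
  moreover have "?S \<noteq> {}" "?S \<subseteq> carrier G"
    using val_closed by (auto simp: connection_words_def)
  ultimately show ?thesis
    unfolding admits_cayley_representation_def by (intro exI[of _ ?S] conjI)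
qed


subsection \<open>Girth and short relations\<close>

lemma less_girth_iff:
  "enat n < girth \<Gamma> \<longleftrightarrow> (\<forall>vs es. multigraph_cycle \<Gamma> vs es \<longrightarrow> n < length vs)"
proof -
  let ?A = "{enat (length vs) |vs es. multigraph_cycle \<Gamma> vs es}"
  have "enat n < Inf ?A \<longleftrightarrow> (\<forall>a\<in>?A. enat n < a)"
  proof
    assume *: "enat n < Inf ?A"
    show "\<forall>a\<in>?A. enat n < a"
      using less_le_trans[OF * Inf_lower] by (rule ballI)
  next
    assume *: "\<forall>a\<in>?A. enat n < a"
    \<comment> \<open>A strict lower bound need not pass to an infimum; over \<open>enat\<close> it
      is the weak bound by \<open>Suc n\<close>, which does.\<close>
    have "enat (Suc n) \<le> a" if "a \<in> ?A" for a
      using bspec[OF * that] unfolding Suc_ile_eq .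
    then have "enat (Suc n) \<le> Inf ?A" by (rule Inf_greatest)
    then show "enat n < Inf ?A" unfolding Suc_ile_eq .
  qed
  also have "\<dots> \<longleftrightarrow> (\<forall>vs es. multigraph_cycle \<Gamma> vs es \<longrightarrow> n < length vs)"
  proof (intro iffI allI impI ballI)
    fix vs es assume *: "\<forall>a\<in>?A. enat n < a" and "multigraph_cycle \<Gamma> vs es"
    then have "enat (length vs) \<in> ?A" by blast
    from bspec[OF * this] show "n < length vs" by simp
  next
    fix a assume *: "\<forall>vs es. multigraph_cycle \<Gamma> vs es \<longrightarrow> n < length vs" and "a \<in> ?A"
    then obtain vs es where "a = enat (length vs)" "multigraph_cycle \<Gamma> vs es" by (elim CollectE exE conjE)
    with * show "enat n < a" by auto
  qed
  finally show ?thesis unfolding girth_def .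
qed

section \<open>Cycles of the Cayley graph and reduced relations\<close>

context generator_pair
begin

text \<open>The edge walked when leaving \<open>g\<close> along the letter \<open>a\<close>. Edges
  are indexed by their source, so an inverse letter walks backwards along the edge that starts at
  its target.\<close>

definition edge_at :: "'a \<Rightarrow> letter \<Rightarrow> 'a \<times> generator" where
  "edge_at g a = (if snd a then g \<otimes> letter_val G x y a else g, fst a)"

lemma generator_closed: "generator_val x y c \<in> carrier G"
  by (cases c) (simp_all add: x_closed y_closed)

lemma letter_val_pair:
  "letter_val G x y a = (if snd a then inv (generator_val x y (fst a)) else generator_val x y (fst a))"
  by (cases a; cases "snd a") auto

lemma ends_edge_at:
  assumes "g \<in> carrier G"
  shows "ends (cayley_graph G x y) (edge_at g a) = {g, g \<otimes> letter_val G x y a}"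
  using assms generator_closed[of "fst a"]
  by (auto simp: cayley_graph_def edge_at_def letter_val_pair m_assoc)

lemma edge_at_in_edges: "g \<in> carrier G \<Longrightarrow> edge_at g a \<in> edges (cayley_graph G x y)"
  using letter_closed[of a] by (simp add: cayley_graph_def edge_at_def)

text \<open>A cancelling pair of letters walks an edge and returns along the same edge.\<close>

lemma edge_at_inverse:
  assumes "g \<in> carrier G" and "inverse_letters a b"
  shows "edge_at (g \<otimes> letter_val G x y a) b = edge_at g a"
  using assms(1) letter_closed[of a] letter_val_inverse[OF assms(2)]
    assms(2)[unfolded inverse_letters_def]
  by (simp add: edge_at_def m_assoc)

text \<open>An edge can be walked in only two directions: equal directions force equal starting
  points, opposite ones inverse letters.\<close>

lemma edge_at_eqD:
  assumes "g \<in> carrier G" "h \<in> carrier G" and "edge_at g a = edge_at h b"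
  shows "g = h \<or> inverse_letters a b"
proof (rule disjCI)
  assume "\<not> inverse_letters a b"
  with assms(3) have "a = b" by (auto simp: edge_at_def inverse_letters_def prod_eq_iff)
  with assms letter_closed[of b] show "g = h" by (simp add: edge_at_def split: if_splits)
qed

lemma edge_at_exists:
  assumes g: "g \<in> carrier G" and h: "h \<in> carrier G" and e: "e \<in> edges (cayley_graph G x y)"
    and ends: "ends (cayley_graph G x y) e = {g, h}"
  obtains a where "edge_at g a = e" "h = g \<otimes> letter_val G x y a"
proof -
  obtain k c where k: "e = (k, c)" "k \<in> carrier G" using e by (auto simp: cayley_graph_def)
  with ends have "{k, k \<otimes> generator_val x y c} = {g, h}" by (simp add: cayley_graph_def)
  then consider "k = g" "h = g \<otimes> generator_val x y c" | "k = h" "g = h \<otimes> generator_val x y c"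
    by (auto simp: doubleton_eq_iff)
  then show thesis
  proof cases
    case 1
    with k show thesis by (intro that[of "(c, False)"]) (auto simp: edge_at_def)
  next
    case 2
    with k h generator_closed[of c] show thesis
      by (intro that[of "(c, True)"]) (auto simp: edge_at_def m_assoc)
  qed
qed

text \<open>The letters read along a cycle multiply to \<open>\<one>\<close>, and a cancelling pair
  of neighbours would repeat an edge.\<close>

lemma cycle_relation:
  assumes cyc: "multigraph_cycle (cayley_graph G x y) vs es"
  obtains w where "reduced w" "length w = length vs" "val w = \<one>"
proof -
  let ?n = "length vs"
  \<comment> \<open>Indices modulo the length close the walk: \<open>v ?n = v 0\<close>.\<close>
  define v where "v i = vs ! (i mod ?n)" for i
  have n: "?n > 0" and es: "distinct es" "length es = ?n" "set es \<subseteq> edges (cayley_graph G x y)"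
    and ends: "\<And>i. i < ?n \<Longrightarrow> ends (cayley_graph G x y) (es ! i) = {v i, v (Suc i)}"
    using cyc by (auto simp: multigraph_cycle_def v_def)
  have vc: "v i \<in> carrier G" for i
  proof -
    have "v i \<in> set vs" using n by (simp add: v_def)
    then show ?thesis using cyc by (auto simp: multigraph_cycle_def cayley_graph_def)
  qed
  have "\<exists>a. edge_at (v i) a = es ! i \<and> v (Suc i) = v i \<otimes> letter_val G x y a" if "i < ?n" for i
    using edge_at_exists[OF vc vc _ ends[OF that]] es that by (metis nth_mem subsetD)
  then obtain l where l: "\<And>i. i < ?n \<Longrightarrow> edge_at (v i) (l i) = es ! i"
    "\<And>i. i < ?n \<Longrightarrow> v (Suc i) = v i \<otimes> letter_val G x y (l i)"
    by metis
  have prefix: "v 0 \<otimes> val (map l [0..<i]) = v i" if "i \<le> ?n" for i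
    using that
  proof (induction i)
    case (Suc i)
    then show ?case
      using l(2)[of i] vc
      by (simp add: val_append val_Cons val_Nil val_closed letter_closed m_assoc[symmetric])
  qed (simp add: val_Nil vc)
  have "v ?n = v 0" by (simp add: v_def)
  then have "val (map l [0..<?n]) = \<one>"
    using prefix[OF le_refl] vc[of 0] val_closed[of "map l [0..<?n]"] by (simp only: l_cancel_one)
  moreover have "reduced (map l [0..<?n])"
    unfolding reduced_def successively_conv_nth
  proof (intro allI impI notI)
    fix i assume i: "Suc i < length (map l [0..<?n])"
      and "inverse_letters (map l [0..<?n] ! i) (map l [0..<?n] ! Suc i)"
    then have "inverse_letters (l i) (l (Suc i))" by simp
    then have "edge_at (v (Suc i)) (l (Suc i)) = edge_at (v i) (l i)"
      using edge_at_inverse[OF vc, of "l i" "l (Suc i)" i] l(2)[of i] i by simp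
    then have "es ! Suc i = es ! i" using l(1) i by simp
    then show False using es i by (simp add: nth_eq_iff_index_eq)
  qed
  ultimately show thesis by (intro that) auto
qed

text \<open>A shortest relation traces a closed walk without repeated vertices, since a repetition
  would cut out a shorter relation; loops and double edges arise for lengths one and two.\<close>

lemma minimal_relation_cycle:
  assumes w: "reduced w" "w \<noteq> []" "val w = \<one>"
    and min: "\<And>v. reduced v \<Longrightarrow> v \<noteq> [] \<Longrightarrow> val v = \<one> \<Longrightarrow> length w \<le> length v"
  obtains vs es where "multigraph_cycle (cayley_graph G x y) vs es" "length vs = length w"
proof -
  let ?n = "length w"
  define v where "v i = val (take i w)" for i
  have vc: "v i \<in> carrier G" for i by (simp add: v_def val_closed)
  have vSuc: "v (Suc i) = v i \<otimes> letter_val G x y (w ! i)" if "i < ?n" for i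
    using that
    by (simp add: v_def take_Suc_conv_app_nth val_append val_Cons val_Nil letter_closed)
  have v0: "v ?n = v 0" using w by (simp add: v_def val_Nil)
  \<comment> \<open>The subword \<open>?u\<close> between two visits of a vertex is reduced,
    non-empty and of value \<open>\<one>\<close>, so by minimality it is all of
    \<open>w\<close>.\<close>
  have vless: "i = 0 \<and> j = ?n" if "i < j" "j \<le> ?n" "v i = v j" for i j
  proof -
    let ?u = "take (j - i) (drop i w)"
    have tj: "take j w = take i w @ ?u"
      using that by (metis le_add_diff_inverse less_imp_le take_add)
    then have "w = take i w @ ?u @ drop j w" by (metis append_assoc append_take_drop_id)
    then have u: "reduced ?u" using reduced_sublist w(1) by metis
    have u1: "val ?u = \<one>"
      using that(3) tj val_closed by (simp add: v_def val_append)
    have "?u \<noteq> []" using that by auto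
    from min[OF u this u1] show ?thesis using that by auto
  qed
  have vinj: "i = j" if "i < ?n" "j < ?n" "v i = v j" for i j
    using vless[of i j] vless[of j i] that by (cases i j rule: linorder_cases) auto
  define e where "e i = edge_at (v i) (w ! i)" for i
  have ends: "ends (cayley_graph G x y) (e i) = {v i, v (Suc i)}" if "i < ?n" for i
    using ends_edge_at[OF vc] vSuc[OF that] by (simp add: e_def)
  have eless: "e i \<noteq> e j" if ij: "i < j" "j < ?n" for i j
  proof
    assume eq: "e i = e j"
    have "v i \<noteq> v j" using vinj[of i j] ij by auto
    with edge_at_eqD[OF vc vc eq[unfolded e_def]] have inv: "inverse_letters (w ! i) (w ! j)" by blast
    \<comment> \<open>A repeated edge is walked in opposite directions, so the first walk ends where
      the second starts. Distinctness of the vertices makes the two letters adjacent, and they would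
      cancel.\<close>
    have "{v i, v (Suc i)} = {v j, v (Suc j)}" using ends[of i] ends[of j] eq ij by simp
    with \<open>v i \<noteq> v j\<close> have "v (Suc i) = v j" by (auto simp: doubleton_eq_iff)
    then have "j = Suc i" using vinj[of "Suc i" j] ij by simp
    then show False using w(1) inv ij by (simp add: reduced_def successively_conv_nth)
  qed
  have einj: "i = j" if "i < ?n" "j < ?n" "e i = e j" for i j
    using eless[of i j] eless[of j i] that by (cases i j rule: linorder_cases) auto
  have "multigraph_cycle (cayley_graph G x y) (map v [0..<?n]) (map e [0..<?n])"
    unfolding multigraph_cycle_def
  proof (intro conjI allI impI)
    show "distinct (map v [0..<?n])" using vinj by (auto simp: distinct_map inj_on_def)
    show "distinct (map e [0..<?n])" using einj by (auto simp: distinct_map inj_on_def)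
    show "set (map v [0..<?n]) \<subseteq> vertices (cayley_graph G x y)"
      using vc by (auto simp: cayley_graph_def)
    show "set (map e [0..<?n]) \<subseteq> edges (cayley_graph G x y)"
      by (simp add: e_def image_subset_iff edge_at_in_edges[OF vc])
    fix i assume "i < length (map v [0..<?n])"
    then have i: "i < ?n" by simp
    have nmod: "Suc i mod ?n < ?n" using w by simp
    \<comment> \<open>Only the last index wraps around, and there \<open>v0\<close> applies.\<close>
    have "v (Suc i mod ?n) = v (Suc i)"
      using i v0 by (cases "Suc i = ?n") auto
    then show "ends (cayley_graph G x y) (map e [0..<?n] ! i) =
        {map v [0..<?n] ! i, map v [0..<?n] ! (Suc i mod length (map v [0..<?n]))}"
      using ends[OF i] i nmod by (simp add: nth_map_upt)
  qed (use w in auto)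
  then show thesis by (intro that) auto
qed

text \<open>Each cycle gives a reduced relation of its length. Conversely, any short relation bounds
  the length of a shortest one, and that one gives a cycle.\<close>

lemma free_up_to_iff_girth: "free_up_to n \<longleftrightarrow> enat n < girth (cayley_graph G x y)"
  unfolding less_girth_iff
proof (intro iffI allI impI)
  fix vs es assume free: "free_up_to n" and cyc: "multigraph_cycle (cayley_graph G x y) vs es"
  obtain w where w: "reduced w" "length w = length vs" "val w = \<one>"
    using cycle_relation[OF cyc] .
  have "w \<noteq> []" using cyc w(2) by (auto simp: multigraph_cycle_def)
  with free w show "n < length vs"
    by (auto simp: free_up_to_def free_words_reduced not_le[symmetric])
next
  assume *: "\<forall>vs es. multigraph_cycle (cayley_graph G x y) vs es \<longrightarrow> n < length vs"
  show "free_up_to n"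
    unfolding free_up_to_def free_words_reduced
  proof (intro ballI impI notI)
    fix u assume u: "u \<in> free_words" "u \<noteq> [] \<and> length u \<le> n" "val u = \<one>"
    let ?P = "\<lambda>w. reduced w \<and> w \<noteq> [] \<and> val w = \<one>"
    have "?P u" using u by (simp add: free_words_reduced)
    then obtain w where w: "?P w" and min: "\<And>v. ?P v \<Longrightarrow> length w \<le> length v"
      using ex_has_least_nat[of ?P u length] by blast
    obtain vs es where "multigraph_cycle (cayley_graph G x y) vs es" "length vs = length w"
      using minimal_relation_cycle[of w] w min by metis
    then show False using * min[OF \<open>?P u\<close>] u by force
  qed
qed

end

theorem theorem8:
  fixes G :: "('a, 'b) monoid_scheme" and x y :: 'a
  assumes "group G"
    and "x \<in> carrier G" and "y \<in> carrier G"
    and "generate G {x, y} = carrier G"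
  shows "((\<forall>w\<in>free_words. w \<noteq> [] \<and> length w \<le> 21 \<longrightarrow> word_val G x y w \<noteq> \<one>\<^bsub>G\<^esub>)
            \<longleftrightarrow> girth (cayley_graph G x y) > 21)
       \<and> ((\<forall>w\<in>free_words. w \<noteq> [] \<and> length w \<le> 21 \<longrightarrow> word_val G x y w \<noteq> \<one>\<^bsub>G\<^esub>)
            \<longrightarrow> admits_cayley_representation G)"
proof -
  interpret group G by fact
  interpret generator_pair G x y by unfold_locales fact+
  \<comment> \<open>The bound on the girth is a numeral of type \<open>enat\<close>, to be read as
    \<open>enat 21\<close>.\<close>
  have girth: "free_up_to 21 \<longleftrightarrow> girth (cayley_graph G x y) > 21"
    using free_up_to_iff_girth[of 21] by (simp only: numeral_eq_enat)
  have "free_up_to 21 \<longrightarrow> admits_cayley_representation G"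
  proof
    assume "free_up_to 21"
    then have "free_up_to 8" by (auto simp: free_up_to_def)
    then show "admits_cayley_representation G" by (rule admits_cayley_representation[OF assms(4)])
  qed
  with girth show ?thesis unfolding free_up_to_def by (rule conjI)
qed

end
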